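(* Let $\mathcal H$ be a real Hilbert space, let $\mu\in\,]0,\infty[$, let $n\ge 1$ be an integer, $I=\{1,\dots,n\}$, and let $\lambda_i>0$ ($i\in I$) satisfy $\sum_{i\in I}\lambda_i=1$. For each $i\in I$ let $A_i:\mathcal H\rightrightarrows\mathcal H$ be maximally monotone and paramonotone, and write $\mathbf A=(A_1,\dots,A_n)$, $\boldsymbol\lambda=(\lambda_1,\dots,\lambda_n)$. Then $\mathcal R_\mu(\mathbf A,\boldsymbol\lambda)$ is paramonotone.
   Context: A monotone mapping $A:\mathcal H\rightrightarrows\mathcal H$ with graph $\operatorname{gra}A=\{(x,u):u\in Ax\}$ is paramonotone if whenever $(x,v),(y,u)\in\operatorname{gra}A$ satisfy $\langle x-y,v-u\rangle=0$, then $(x,u)$ and $(y,v)$ are also in $\operatorname{gra}A$. $A^{-1}$ is the set-valued mapping with $x\in A^{-1}u\Leftrightarrow u\in Ax$. Sums and scalar multiples of set-valued mappings are pointwise Minkowski operations; $\mathrm{Id}$ is the identity. The $\boldsymbol\lambda$-weighted resolvent average of $\mathbf A$ with parameter $\mu$ is the set-valued mapping $$\mathcal R_\mu(\mathbf A,\boldsymbol\lambda)=\Big(\sum_{i\in I}\lambda_i(A_i+\mu^{-1}\mathrm{Id})^{-1}\Big)^{-1}-\mu^{-1}\mathrm{Id}.$$ *)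

theory Defs
  imports "HOL-Analysis.Analysis" "HOL-Library.Set_Algebras"
begin

text \<open>
  A set-valued mapping from \<open>H\<close> to \<open>H\<close> is a function of type \<open>'a \<Rightarrow> 'a set\<close>. A real Hilbert space is a type of
  sort \<open>{real_inner, complete_space}\<close>; definitions that do not need completeness ask only for less.
\<close>

definition gra :: "('a \<Rightarrow> 'a set) \<Rightarrow> ('a \<times> 'a) set"
  where "gra A = {(x, u). u \<in> A x}"

definition monotone_map :: "('a::real_inner \<Rightarrow> 'a set) \<Rightarrow> bool"
  where "monotone_map A \<longleftrightarrow>
    (\<forall>x u y v. (x, u) \<in> gra A \<longrightarrow> (y, v) \<in> gra A \<longrightarrow> (x - y) \<bullet> (u - v) \<ge> 0)"

definition maximally_monotone :: "('a::real_inner \<Rightarrow> 'a set) \<Rightarrow> bool"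
  where "maximally_monotone A \<longleftrightarrow>
    monotone_map A \<and> (\<forall>B. monotone_map B \<longrightarrow> gra A \<subseteq> gra B \<longrightarrow> gra B = gra A)"

definition paramonotone :: "('a::real_inner \<Rightarrow> 'a set) \<Rightarrow> bool"
  where "paramonotone A \<longleftrightarrow>
    monotone_map A \<and>
    (\<forall>x v y u. (x, v) \<in> gra A \<longrightarrow> (y, u) \<in> gra A \<longrightarrow> (x - y) \<bullet> (v - u) = 0 \<longrightarrow>
       (x, u) \<in> gra A \<and> (y, v) \<in> gra A)"

definition map_inverse :: "('a \<Rightarrow> 'a set) \<Rightarrow> 'a \<Rightarrow> 'a set"
  where "map_inverse A u = {x. u \<in> A x}"

definition map_Id :: "'a \<Rightarrow> 'a set"
  where "map_Id x = {x}"

text \<open>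
  On sets, \<open>+\<close> and \<open>\<Sum>\<close> below are the Minkowski operations of \<^theory>\<open>HOL-Library.Set_Algebras\<close>.
  The operation \<open>-\<close> on sets is set difference, so subtracting a multiple of the identity is
  written as adding the opposite multiple.
\<close>

definition map_plus :: "('a::plus \<Rightarrow> 'a set) \<Rightarrow> ('a \<Rightarrow> 'a set) \<Rightarrow> 'a \<Rightarrow> 'a set"
  where "map_plus A B x = A x + B x"

definition map_sum :: "('i \<Rightarrow> 'a::comm_monoid_add \<Rightarrow> 'a set) \<Rightarrow> 'i set \<Rightarrow> 'a \<Rightarrow> 'a set"
  where "map_sum A I x = (\<Sum>i\<in>I. A i x)"

definition map_scale :: "real \<Rightarrow> ('a::real_vector \<Rightarrow> 'a set) \<Rightarrow> 'a \<Rightarrow> 'a set"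
  where "map_scale c A x = (\<lambda>u. c *\<^sub>R u) ` A x"

definition resolvent_average ::
    "real \<Rightarrow> 'i set \<Rightarrow> ('i \<Rightarrow> 'a::real_vector \<Rightarrow> 'a set) \<Rightarrow> ('i \<Rightarrow> real) \<Rightarrow> 'a \<Rightarrow> 'a set"
  where "resolvent_average \<mu> I A lam =
    map_plus
      (map_inverse
        (map_sum (\<lambda>i. map_scale (lam i)
            (map_inverse (map_plus (A i) (map_scale (inverse \<mu>) map_Id)))) I))
      (map_scale (- inverse \<mu>) map_Id)"

end

theory Submission
  imports Defs
begin

text \<open>
  Put \<open>c = \<mu>\<inverse>\<close>. A pair \<open>(x, v)\<close> lies in the graph of the resolvent average iff \<open>x = (\<Sum>i. \<lambda>\<^sub>i x\<^sub>i)\<close> for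
  points \<open>x\<^sub>i\<close> such that \<open>v + c (x - x\<^sub>i) \<in> A\<^sub>i x\<^sub>i\<close> (lemma \<open>mem_resolvent_average_iff\<close>). If \<open>(y, u)\<close> is
  another such pair, with points \<open>y\<^sub>i\<close>, then with \<open>d\<^sub>i = x\<^sub>i - y\<^sub>i\<close> and \<open>d = x - y = (\<Sum>i. \<lambda>\<^sub>i d\<^sub>i)\<close>
  lemma \<open>weighted_inner_decomposition\<close> gives
  \<open>\<langle>x - y, v - u\<rangle> = (\<Sum>i. \<lambda>\<^sub>i \<langle>d\<^sub>i, (v - u) + c (d - d\<^sub>i)\<rangle>) + c (\<Sum>i. \<lambda>\<^sub>i \<parallel>d\<^sub>i - d\<parallel>\<^sup>2)\<close>.
  Monotonicity of the \<open>A\<^sub>i\<close> makes every summand on the right nonnegative, so the resolvent average is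
  monotone. If the left side vanishes, then so does every summand: the shifts satisfy
  \<open>x\<^sub>i - y\<^sub>i = x - y\<close>, and paramonotonicity of \<open>A\<^sub>i\<close> allows exchanging the values at \<open>x\<^sub>i\<close> and \<open>y\<^sub>i\<close>.
  Since \<open>x - x\<^sub>i = y - y\<^sub>i\<close>, the exchanged values certify that \<open>(x, u)\<close> and \<open>(y, v)\<close> belong to the
  graph of the average.
\<close>

lemma mem_resolvent_average_iff:
  fixes A :: "'i \<Rightarrow> 'a::real_vector \<Rightarrow> 'a set"
  assumes "finite I"
  shows "v \<in> resolvent_average \<mu> I A lam x \<longleftrightarrow>
    (\<exists>s. x = (\<Sum>i\<in>I. lam i *\<^sub>R s i) \<and> (\<forall>i\<in>I. v + inverse \<mu> *\<^sub>R (x - s i) \<in> A i (s i)))"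
proof -
  let ?c = "inverse \<mu>"
  let ?w = "v + ?c *\<^sub>R x"
  have plus: "w \<in> map_plus B (map_scale r map_Id) y \<longleftrightarrow> w - r *\<^sub>R y \<in> B y"
    for B :: "'a \<Rightarrow> 'a set" and w y r
    by (auto simp: map_plus_def map_scale_def map_Id_def set_plus_def)
      (metis diff_add_cancel)
  have "v \<in> resolvent_average \<mu> I A lam x \<longleftrightarrow>
      x \<in> (\<Sum>i\<in>I. (\<lambda>u. lam i *\<^sub>R u) ` {y. ?w - ?c *\<^sub>R y \<in> A i y})"
    unfolding resolvent_average_def plus
    by (simp add: map_inverse_def map_sum_def map_scale_def [of "lam _"] plus)
  also have "\<dots> \<longleftrightarrow> (\<exists>t. x = sum t I \<and>
      (\<forall>i\<in>I. t i \<in> (\<lambda>u. lam i *\<^sub>R u) ` {y. ?w - ?c *\<^sub>R y \<in> A i y}))"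
    by (simp add: set_sum_alt [OF assms])
  also have "\<dots> \<longleftrightarrow> (\<exists>s. x = (\<Sum>i\<in>I. lam i *\<^sub>R s i) \<and> (\<forall>i\<in>I. ?w - ?c *\<^sub>R s i \<in> A i (s i)))"
  proof
    assume "\<exists>t. x = sum t I \<and>
      (\<forall>i\<in>I. t i \<in> (\<lambda>u. lam i *\<^sub>R u) ` {y. ?w - ?c *\<^sub>R y \<in> A i y})"
    then obtain t where x: "x = sum t I"
      and "\<forall>i\<in>I. \<exists>y. t i = lam i *\<^sub>R y \<and> ?w - ?c *\<^sub>R y \<in> A i y"
      by blast
    then obtain s where s: "\<forall>i\<in>I. t i = lam i *\<^sub>R s i \<and> ?w - ?c *\<^sub>R s i \<in> A i (s i)"
      by metis
    then have "x = (\<Sum>i\<in>I. lam i *\<^sub>R s i)"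
      unfolding x by (intro sum.cong) auto
    with s show "\<exists>s. x = (\<Sum>i\<in>I. lam i *\<^sub>R s i) \<and> (\<forall>i\<in>I. ?w - ?c *\<^sub>R s i \<in> A i (s i))"
      by blast
  next
    assume "\<exists>s. x = (\<Sum>i\<in>I. lam i *\<^sub>R s i) \<and> (\<forall>i\<in>I. ?w - ?c *\<^sub>R s i \<in> A i (s i))"
    then obtain s where "x = (\<Sum>i\<in>I. lam i *\<^sub>R s i)" "\<forall>i\<in>I. ?w - ?c *\<^sub>R s i \<in> A i (s i)"
      by blast
    then show "\<exists>t. x = sum t I \<and>
      (\<forall>i\<in>I. t i \<in> (\<lambda>u. lam i *\<^sub>R u) ` {y. ?w - ?c *\<^sub>R y \<in> A i y})"
      by (intro exI [of _ "\<lambda>i. lam i *\<^sub>R s i"]) auto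
  qed
  finally show ?thesis
    by (simp add: algebra_simps)
qed

text \<open>
  The weights sum to one, so the last sum is the variance \<open>(\<Sum>i. \<lambda>\<^sub>i \<parallel>e\<^sub>i\<parallel>\<^sup>2) - \<parallel>d\<parallel>\<^sup>2\<close> of the \<open>e\<^sub>i\<close>, which
  cancels the \<open>c\<close>-terms of the first sum.
\<close>

lemma weighted_inner_decomposition:
  fixes e :: "'i \<Rightarrow> 'a::real_inner"
  assumes weights: "sum lam I = 1" and d: "d = (\<Sum>i\<in>I. lam i *\<^sub>R e i)"
  shows "d \<bullet> p = (\<Sum>i\<in>I. lam i * (e i \<bullet> (p + c *\<^sub>R (d - e i))))
    + c * (\<Sum>i\<in>I. lam i * ((e i - d) \<bullet> (e i - d)))"
proof -
  have lin: "(\<Sum>i\<in>I. lam i * (e i \<bullet> q)) = d \<bullet> q" for q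
    by (simp add: d inner_sum_left)
  have "(\<Sum>i\<in>I. lam i * (e i \<bullet> (p + c *\<^sub>R (d - e i))))
      + c * (\<Sum>i\<in>I. lam i * ((e i - d) \<bullet> (e i - d)))
      = (\<Sum>i\<in>I. lam i * (e i \<bullet> p) - c * (lam i * (e i \<bullet> d)) + lam i * (c * (d \<bullet> d)))"
    unfolding sum_distrib_left sum.distrib [symmetric]
    by (rule sum.cong) (simp_all add: algebra_simps inner_commute)
  also have "\<dots> = d \<bullet> p - c * (d \<bullet> d) + 1 * (c * (d \<bullet> d))"
    by (simp only: sum.distrib sum_subtractf sum_distrib_left [symmetric]
        sum_distrib_right [symmetric] lin weights)
  finally show ?thesis
    by simp
qed

lemma paramonotone_resolvent_average:
  fixes A :: "'i \<Rightarrow> 'a::real_inner \<Rightarrow> 'a set"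
  assumes "\<mu> > 0" and "finite I"
    and pos: "\<And>i. i \<in> I \<Longrightarrow> lam i > 0" and weights: "sum lam I = 1"
    and para: "\<And>i. i \<in> I \<Longrightarrow> paramonotone (A i)"
  shows "paramonotone (resolvent_average \<mu> I A lam)"
proof -
  let ?R = "resolvent_average \<mu> I A lam"
  define c where "c = inverse \<mu>"
  have "c > 0"
    using \<open>\<mu> > 0\<close> by (simp add: c_def)
  note mem = mem_resolvent_average_iff [OF \<open>finite I\<close>, of _ \<mu> A lam, folded c_def]
  have key: "(x - y) \<bullet> (v - u) \<ge> 0 \<and> ((x - y) \<bullet> (v - u) = 0 \<longrightarrow> u \<in> ?R x \<and> v \<in> ?R y)"
    if vx: "v \<in> ?R x" and uy: "u \<in> ?R y" for x y v u
  proof -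
    obtain s where x: "x = (\<Sum>i\<in>I. lam i *\<^sub>R s i)"
      and s: "\<And>i. i \<in> I \<Longrightarrow> v + c *\<^sub>R (x - s i) \<in> A i (s i)"
      using vx unfolding mem by blast
    obtain t where y: "y = (\<Sum>i\<in>I. lam i *\<^sub>R t i)"
      and t: "\<And>i. i \<in> I \<Longrightarrow> u + c *\<^sub>R (y - t i) \<in> A i (t i)"
      using uy unfolding mem by blast
    define d where "d = x - y"
    define e where "e i = s i - t i" for i
    define g where "g i = e i \<bullet> ((v - u) + c *\<^sub>R (d - e i))" for i
    have d: "d = (\<Sum>i\<in>I. lam i *\<^sub>R e i)"
      by (simp add: d_def e_def x y scaleR_diff_right sum_subtractf)
    have g_eq: "g i = (s i - t i) \<bullet> ((v + c *\<^sub>R (x - s i)) - (u + c *\<^sub>R (y - t i)))" for i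
      by (simp add: g_def d_def e_def algebra_simps)
    have g_nonneg: "g i \<ge> 0" if "i \<in> I" for i
      using para [OF that] s [OF that] t [OF that]
      unfolding g_eq paramonotone_def monotone_map_def gra_def by blast
    let ?S = "\<Sum>i\<in>I. lam i * g i" and ?V = "\<Sum>i\<in>I. lam i * ((e i - d) \<bullet> (e i - d))"
    have decomp: "d \<bullet> (v - u) = ?S + c * ?V"
      unfolding g_def by (rule weighted_inner_decomposition [OF weights d])
    have S_terms: "\<And>i. i \<in> I \<Longrightarrow> 0 \<le> lam i * g i"
      using pos g_nonneg by (simp add: less_imp_le)
    have V_terms: "\<And>i. i \<in> I \<Longrightarrow> 0 \<le> lam i * ((e i - d) \<bullet> (e i - d))"
      using pos by (simp add: less_imp_le)
    have "?S \<ge> 0" "?V \<ge> 0"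
      using S_terms V_terms by (simp_all add: sum_nonneg)
    then have "c * ?V \<ge> 0"
      using \<open>c > 0\<close> by simp
    have "u \<in> ?R x \<and> v \<in> ?R y" if "d \<bullet> (v - u) = 0"
    proof -
      have "?S = 0" "c * ?V = 0"
        using that decomp \<open>?S \<ge> 0\<close> \<open>c * ?V \<ge> 0\<close> by linarith+
      then have "?V = 0"
        using \<open>c > 0\<close> by simp
      have g0: "g i = 0" if "i \<in> I" for i
        using \<open>?S = 0\<close> S_terms pos [OF that] that \<open>finite I\<close>
        by (simp add: sum_nonneg_eq_0_iff) force
      have e_eq: "e i = d" if "i \<in> I" for i
        using \<open>?V = 0\<close> V_terms pos [OF that] that \<open>finite I\<close>
        by (simp add: sum_nonneg_eq_0_iff) force
      have shift: "x - s i = y - t i" if "i \<in> I" for i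
        using e_eq [OF that] by (simp add: d_def e_def algebra_simps)
      have swap: "u + c *\<^sub>R (y - t i) \<in> A i (s i)" "v + c *\<^sub>R (x - s i) \<in> A i (t i)"
        if "i \<in> I" for i
        using para [OF that] s [OF that] t [OF that] g0 [OF that]
        unfolding g_eq paramonotone_def gra_def by blast+
      have "u \<in> ?R x"
        unfolding mem using x swap(1) shift by (intro exI [of _ s]) auto
      moreover have "v \<in> ?R y"
        unfolding mem using y swap(2) shift by (intro exI [of _ t]) auto
      ultimately show ?thesis ..
    qed
    then show ?thesis
      using decomp \<open>?S \<ge> 0\<close> \<open>c * ?V \<ge> 0\<close> by (simp add: d_def)
  qed
  show ?thesis
    unfolding paramonotone_def monotone_map_def gra_def using key by blast
qed

theorem theorem4p7:
  fixes \<mu> :: real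
    and n :: nat
    and lam :: "nat \<Rightarrow> real"
    and A :: "nat \<Rightarrow> 'a::{real_inner, complete_space} \<Rightarrow> 'a set"
  assumes "\<mu> > 0"
    and "n \<ge> 1"
    and "\<And>i. i \<in> {1..n} \<Longrightarrow> lam i > 0"
    and "(\<Sum>i\<in>{1..n}. lam i) = 1"
    and "\<And>i. i \<in> {1..n} \<Longrightarrow> maximally_monotone (A i)"
    and "\<And>i. i \<in> {1..n} \<Longrightarrow> paramonotone (A i)"
  shows "paramonotone (resolvent_average \<mu> {1..n} A lam)"
  using assms(1,3,4,6) by (intro paramonotone_resolvent_average) auto

end
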